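(* Let $\mathcal{S}$ be an FSA with observer $\mathcal{S}_{obs}$ and detector $\mathcal{S}_{det}$. For every transition $(q,\sigma,q')\in\delta_{obs}$ (with $\sigma\in\Sigma$) and for every nonempty $\bar q'\subset q'$ satisfying $|\bar q'|=2$ if $|q'|\ge 2$, there is $\bar q\subset q$ such that $(\bar q,\sigma,\bar q')\in\delta_{det}$, where $|\bar q|=2$ if $|q|\ge 2$.
   Context: The symbol $\subset$ denotes the (not necessarily proper) subset relation. For a finite alphabet $A$, $A^*$ denotes the set of finite words over $A$, including the empty word $\epsilon$. $|S|$ is the cardinality of a set $S$, and $2^S$ its power set. A finite-state automaton (FSA) is a sextuple $\mathcal{S}=(X,T,X_0,\delta,\Sigma,\ell)$, where $X$ is a finite set of states, $T$ a finite set of events, $X_0\subset X$ a set of initial states, $\delta\subset X\times T\times X$ a transition relation, $\Sigma$ a finite set of outputs (labels), and $\ell:T\to\Sigma\cup\{\epsilon\}$ a labeling function, extended to $\ell:T^*\to\Sigma^*$ by $\ell(t_1t_2\dots)=\ell(t_1)\ell(t_2)\dots$, $\ell(\epsilon)=\epsilon$. $T_{uo}=\{t\in T:\ell(t)=\epsilon\}$ is the set of unobservable events. $\delta$ is extended to $\delta\subset X\times T^*\times X$ in the usual way; $x\xrightarrow{s}x'$ means $(x,s,x')\in\delta$. For $\sigma\in\Sigma^*$, the current-state estimate is $\mathcal{M}(\mathcal{S},\sigma)=\{x\in X : \exists x_0\in X_0,\ \exists s\in T^*,\ \ell(s)=\sigma \text{ and } x_0\xrightarrow{s}x\}$. For $x\in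 X$, the unobservable reach is $\mathrm{UR}(x)=\{x'\in X:\exists s\in(T_{uo})^*,\ (x,s,x')\in\delta\}$, and for $\sigma\in\Sigma$ the observable reach is $\mathrm{Reach}_\sigma(x)=\{x'\in X:\exists t\in T,\ (x,t,x')\in\delta,\ \ell(t)=\sigma\}$. For $X'\subset X$, $\mathrm{UR}(X')=\bigcup_{x\in X'}\mathrm{UR}(x)$ and $\mathrm{Reach}_\sigma(X')=\bigcup_{x\in X'}\mathrm{Reach}_\sigma(x)$. The observer $\mathcal{S}_{obs}=(2^X\setminus\{\emptyset\},\Sigma,\mathcal{M}(\mathcal{S},\epsilon),\delta_{obs})$ is the deterministic automaton with unique initial state $\mathcal{M}(\mathcal{S},\epsilon)$ such that for all nonempty $X'\in 2^X$ and $\sigma\in\Sigma^*$, $\delta_{obs}(\mathcal{M}(\mathcal{S},\epsilon),\sigma)=X'$ if and only if $X'=\mathcal{M}(\mathcal{S},\sigma)$; that is, its transitions are $(\mathcal{M}(\mathcal{S},\tau),a,\mathcal{M}(\mathcal{S},\tau a))$ for $\tau\in\Sigma^*$, $a\in\Sigma$ with $\mathcal{M}(\mathcal{S},\tau a)\ne\emptyset$. The detector $\mathcal{S}_{det}=(Q,\Sigma,\mathcal{M}(\mathcal{S},\epsilon),\delta_{det})$ is the nondeterministic automaton with initial state $\mathcal{M}(\mathcal{S},\epsilon)$, where $Q\subset 2^X\setminus\{\emptyset\}$ consists of $\mathcal{M}(\mathcal{S},\epsilon)$ and the nonempty subsets of $X$ of cardinality $\le 2$; for all $q,q'\in Q$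 and $\sigma\in\Sigma$, $(q,\sigma,q')\in\delta_{det}$ if and only if either (1) $|\mathrm{UR}(\mathrm{Reach}_\sigma(q))|>1$, $q'\subset\mathrm{UR}(\mathrm{Reach}_\sigma(q))$, and $|q'|=2$, or (2) $|\mathrm{UR}(\mathrm{Reach}_\sigma(q))|=1$ and $q'=\mathrm{UR}(\mathrm{Reach}_\sigma(q))$. *)

theory Defs
  imports Main
begin

text \<open>The empty label is represented by \<open>None\<close>: an event \<open>t\<close> with \<open>label S t = None\<close> is
  unobservable. The fields of the record are only meaningful under the assumptions of
  the locale \<open>fsa\<close> below.\<close>

record ('x, 't, 'o) automaton =
  states :: "'x set"
  events :: "'t set"
  inits :: "'x set"
  delta :: "('x \<times> 't \<times> 'x) set"
  outputs :: "'o set"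
  label :: "'t \<Rightarrow> 'o option"

locale fsa =
  fixes S :: "('x, 't, 'o) automaton"
  assumes finite_states: "finite (states S)"
    and finite_events: "finite (events S)"
    and finite_outputs: "finite (outputs S)"
    and inits_subset: "inits S \<subseteq> states S"
    and delta_subset: "delta S \<subseteq> states S \<times> events S \<times> states S"
    and label_in: "t \<in> events S \<Longrightarrow> label S t \<in> insert None (Some ` outputs S)"

definition label_word :: "('x, 't, 'o) automaton \<Rightarrow> 't list \<Rightarrow> 'o list" where
  "label_word S s = List.map_filter (label S) s"

definition unobs_events :: "('x, 't, 'o) automaton \<Rightarrow> 't set" where
  "unobs_events S = {t \<in> events S. label S t = None}"

inductive_set delta_star :: "('x, 't, 'o) automaton \<Rightarrow> ('x \<times> 't list \<times> 'x) set"
  for S :: "('x, 't, 'o) automaton" where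
  empty: "x \<in> states S \<Longrightarrow> (x, [], x) \<in> delta_star S"
| step: "(x, t, y) \<in> delta S \<Longrightarrow> (y, s, z) \<in> delta_star S \<Longrightarrow> (x, t # s, z) \<in> delta_star S"

definition estimate :: "('x, 't, 'o) automaton \<Rightarrow> 'o list \<Rightarrow> 'x set" where
  "estimate S w = {x \<in> states S. \<exists>x0 \<in> inits S. \<exists>s \<in> lists (events S).
     label_word S s = w \<and> (x0, s, x) \<in> delta_star S}"

definition UR :: "('x, 't, 'o) automaton \<Rightarrow> 'x \<Rightarrow> 'x set" where
  "UR S x = {x' \<in> states S. \<exists>s \<in> lists (unobs_events S). (x, s, x') \<in> delta_star S}"

definition Reach :: "('x, 't, 'o) automaton \<Rightarrow> 'o \<Rightarrow> 'x \<Rightarrow> 'x set" where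
  "Reach S a x = {x' \<in> states S. \<exists>t \<in> events S. (x, t, x') \<in> delta S \<and> label S t = Some a}"

definition UR_set :: "('x, 't, 'o) automaton \<Rightarrow> 'x set \<Rightarrow> 'x set" where
  "UR_set S A = (\<Union>x \<in> A. UR S x)"

definition Reach_set :: "('x, 't, 'o) automaton \<Rightarrow> 'o \<Rightarrow> 'x set \<Rightarrow> 'x set" where
  "Reach_set S a A = (\<Union>x \<in> A. Reach S a x)"

text \<open>Label-free automata with a single initial state; the observer and the detector are of
  this kind. The deterministic partial transition function of the observer is given by
  its graph.\<close>

record ('q, 'o) transition_system =
  nodes :: "'q set"
  alphabet :: "'o set"
  initial :: "'q"
  transitions :: "('q \<times> 'o \<times> 'q) set"

definition observer :: "('x, 't, 'o) automaton \<Rightarrow> ('x set, 'o) transition_system" where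
  "observer S =
    \<lparr> nodes = Pow (states S) - {{}},
      alphabet = outputs S,
      initial = estimate S [],
      transitions = {(estimate S w, a, estimate S (w @ [a])) | w a.
                       w \<in> lists (outputs S) \<and> a \<in> outputs S \<and> estimate S (w @ [a]) \<noteq> {}} \<rparr>"

text \<open>The empty set is never a detector state, even when the initial estimate is empty
  (that is, when there are no initial states).\<close>

definition detector_states :: "('x, 't, 'o) automaton \<Rightarrow> 'x set set" where
  "detector_states S = {q \<in> Pow (states S) - {{}}. q = estimate S [] \<or> card q \<le> 2}"

definition detector :: "('x, 't, 'o) automaton \<Rightarrow> ('x set, 'o) transition_system" where
  "detector S =
    \<lparr> nodes = detector_states S,
      alphabet = outputs S,
      initial = estimate S [],
      transitions = {(q, a, q'). q \<in> detector_states S \<and> q' \<in> detector_states S \<and> a \<in> outputs S \<and>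
        (let R = UR_set S (Reach_set S a q)
         in card R > 1 \<and> q' \<subseteq> R \<and> card q' = 2 \<or> card R = 1 \<and> q' = R)} \<rparr>"

end

theory Submission
  imports Defs
begin

text \<open>The set \<open>UR_set S (Reach_set S a q)\<close> is the union, over \<open>x \<in> q\<close>, of the same expression
  for \<open>{x}\<close>, and it equals the estimate following \<open>q\<close> in the observer. Hence each of the at most two
  elements of \<open>r'\<close> has a predecessor in \<open>q\<close>; the predecessors form \<open>r\<close>, padded by an
  arbitrary state of \<open>q\<close> if they coincide.\<close>

lemma label_word_Nil [simp]: "label_word S [] = []"
  by (simp add: label_word_def List.map_filter_def)

lemma label_word_Cons:
  "label_word S (t # s) = (case label S t of None \<Rightarrow> label_word S s | Some a \<Rightarrow> a # label_word S s)"
  by (simp add: label_word_def List.map_filter_def split: option.split)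

lemma label_word_append: "label_word S (s @ s') = label_word S s @ label_word S s'"
  by (simp add: label_word_def List.map_filter_def)

text \<open>Splits a run at its last observable event \<open>t\<close>. In the reverse induction a
  final unobservable event is absorbed into \<open>s2\<close>, while a final observable one is
  itself \<open>t\<close>, with \<open>s2\<close> empty.\<close>

lemma label_word_eq_snocD:
  assumes "label_word S s = w @ [a]"
  shows "\<exists>s1 t s2. s = s1 @ t # s2 \<and> label_word S s1 = w \<and> label S t = Some a \<and> label_word S s2 = []"
  using assms
proof (induction s rule: rev_induct)
  case Nil
  then show ?case by simp
next
  case (snoc t s)
  show ?case
  proof (cases "label S t")
    case None
    then have "label_word S s = w @ [a]"
      using snoc.prems by (simp add: label_word_append label_word_Cons)
    then obtain s1 u s2 where "s = s1 @ u # s2" "label_word S s1 = w" "label S u = Some a"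
      "label_word S s2 = []"
      using snoc.IH by blast
    with None have "s @ [t] = s1 @ u # (s2 @ [t])" "label_word S (s2 @ [t]) = []"
      by (simp_all add: label_word_append label_word_Cons)
    then show ?thesis
      using \<open>label_word S s1 = w\<close> \<open>label S u = Some a\<close> by blast
  next
    case (Some b)
    then have "label_word S s = w" "b = a"
      using snoc.prems by (simp_all add: label_word_append label_word_Cons)
    then show ?thesis
      using Some label_word_Nil by blast
  qed
qed

text \<open>Translates between the words that define \<open>UR\<close> and the label condition on
  \<open>s2\<close> produced by \<open>label_word_eq_snocD\<close>.\<close>

lemma lists_unobs_events_iff:
  "s \<in> lists (unobs_events S) \<longleftrightarrow> s \<in> lists (events S) \<and> label_word S s = []"
  by (induction s) (auto simp: unobs_events_def label_word_Cons split: option.splits)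

lemma UR_set_mono: "A \<subseteq> B \<Longrightarrow> UR_set S A \<subseteq> UR_set S B"
  by (auto simp: UR_set_def)

lemma Reach_set_mono: "A \<subseteq> B \<Longrightarrow> Reach_set S a A \<subseteq> Reach_set S a B"
  by (auto simp: Reach_set_def)

lemma mem_UR_Reach_set_iff:
  "z \<in> UR_set S (Reach_set S a A) \<longleftrightarrow> (\<exists>x\<in>A. z \<in> UR_set S (Reach_set S a {x}))"
  by (auto simp: UR_set_def Reach_set_def)

lemma estimate_subset_states: "estimate S w \<subseteq> states S"
  by (auto simp: estimate_def)

context fsa
begin

lemma delta_star_states: "(x, s, y) \<in> delta_star S \<Longrightarrow> x \<in> states S \<and> y \<in> states S"
  by (induction rule: delta_star.induct) (use delta_subset in auto)

lemma delta_star_Cons_iff: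
  "(x, t # s, z) \<in> delta_star S \<longleftrightarrow> (\<exists>y. (x, t, y) \<in> delta S \<and> (y, s, z) \<in> delta_star S)"
  by (auto elim: delta_star.cases intro: delta_star.step)

lemma delta_star_append_iff:
  "(x, s @ s', z) \<in> delta_star S \<longleftrightarrow>
    (\<exists>y. (x, s, y) \<in> delta_star S \<and> (y, s', z) \<in> delta_star S)"
proof (induction s arbitrary: x)
  case Nil
  show ?case
    \<comment> \<open>The midpoint is \<open>x\<close> itself; the empty run at \<open>x\<close>
      requires \<open>x\<close> to be a state, which the run along \<open>s'\<close>
      guarantees.\<close>
    by (auto elim: delta_star.cases dest: delta_star_states intro!: delta_star.empty exI[of _ x])
next
  case (Cons t s)
  then show ?case
    by (auto simp: delta_star_Cons_iff)
qed

text \<open>A run labelled \<open>w @ [a]\<close> is a run labelled \<open>w\<close>, one event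
  labelled \<open>a\<close> and an unobservable tail. Unobservable events before the
  \<open>a\<close>-event belong to the first piece, so closing under \<open>UR\<close> after
  \<open>Reach\<close> suffices.\<close>

lemma estimate_snoc: "estimate S (w @ [a]) = UR_set S (Reach_set S a (estimate S w))"
proof (intro set_eqI iffI)
  fix z
  assume "z \<in> estimate S (w @ [a])"
  then obtain x0 s where x0: "x0 \<in> inits S" "s \<in> lists (events S)" "label_word S s = w @ [a]"
    "(x0, s, z) \<in> delta_star S"
    by (auto simp: estimate_def)
  obtain s1 t s2 where s: "s = s1 @ t # s2" "label_word S s1 = w" "label S t = Some a"
    "label_word S s2 = []"
    using label_word_eq_snocD[OF x0(3)] by blast
  obtain x y where xy: "(x0, s1, x) \<in> delta_star S" "(x, t, y) \<in> delta S" "(y, s2, z) \<in> delta_star S"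
    using x0(4) by (auto simp: s(1) delta_star_append_iff delta_star_Cons_iff)
  have "x \<in> estimate S w"
    using x0 s xy delta_star_states by (auto simp: estimate_def)
  moreover have "y \<in> Reach S a x"
    using x0(2) s xy delta_star_states by (auto simp: Reach_def)
  moreover have "s2 \<in> lists (unobs_events S)"
    using x0(2) s by (simp add: lists_unobs_events_iff)
  then have "z \<in> UR S y"
    using xy(3) delta_star_states by (auto simp: UR_def)
  ultimately show "z \<in> UR_set S (Reach_set S a (estimate S w))"
    by (auto simp: UR_set_def Reach_set_def)
next
  fix z
  assume "z \<in> UR_set S (Reach_set S a (estimate S w))"
  then obtain x y where xy: "x \<in> estimate S w" "y \<in> Reach S a x" "z \<in> UR S y"
    by (auto simp: UR_set_def Reach_set_def)
  obtain x0 s1 where s1: "x0 \<in> inits S" "s1 \<in> lists (events S)" "label_word S s1 = w"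
    "(x0, s1, x) \<in> delta_star S"
    using xy(1) by (auto simp: estimate_def)
  obtain t where t: "t \<in> events S" "(x, t, y) \<in> delta S" "label S t = Some a"
    using xy(2) by (auto simp: Reach_def)
  obtain s2 where s2: "s2 \<in> lists (unobs_events S)" "(y, s2, z) \<in> delta_star S"
    using xy(3) by (auto simp: UR_def)
  have "(x0, s1 @ t # s2, z) \<in> delta_star S"
    using s1 t s2 by (auto simp: delta_star_append_iff delta_star_Cons_iff)
  moreover have "label_word S (s1 @ t # s2) = w @ [a]"
    using s1 t s2 by (simp add: label_word_append label_word_Cons lists_unobs_events_iff)
  moreover have "s1 @ t # s2 \<in> lists (events S)"
    using s1 t s2(1) by (simp add: lists_unobs_events_iff)
  ultimately show "z \<in> estimate S (w @ [a])"
    using s1(1) delta_star_states unfolding estimate_def by blast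
qed

end

text \<open>Pads a set of predecessors up to size two inside \<open>q\<close>. If \<open>q\<close>
  has fewer than two elements, \<open>q\<close> itself serves as \<open>r\<close>.\<close>

lemma obtain_card_2_superset:
  assumes "finite q" "p \<subseteq> q" "p \<noteq> {}" "card p \<le> 2"
  obtains r where "p \<subseteq> r" "r \<subseteq> q" "card r \<le> 2" "card q \<ge> 2 \<longrightarrow> card r = 2"
proof (cases "card q \<ge> 2")
  case True
  then obtain r where "p \<subseteq> r" "r \<subseteq> q" "card r = 2"
    using exists_subset_between[of p 2 q] assms by blast
  then show ?thesis by (intro that) auto
next
  case False
  then show ?thesis using assms by (intro that[of q]) auto
qed

theorem proposition4p5:
  fixes S :: "('x, 't, 'o) automaton"
    and a :: 'o
    and q q' r' :: "'x set"
  assumes "fsa S"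
    and "(q, a, q') \<in> transitions (observer S)"
    and "r' \<subseteq> q'" and "r' \<noteq> {}"
    and "card q' \<ge> 2 \<longrightarrow> card r' = 2"
  shows "\<exists>r \<subseteq> q. (r, a, r') \<in> transitions (detector S) \<and> (card q \<ge> 2 \<longrightarrow> card r = 2)"
proof -
  interpret fsa S by fact
  let ?R = "\<lambda>p. UR_set S (Reach_set S a p)"
  obtain w where w: "q = estimate S w" "q' = estimate S (w @ [a])" "a \<in> outputs S"
    using assms(2) by (auto simp: observer_def)
  \<comment> \<open>Removes the word \<open>w\<close> that witnesses the observer transition:
    \<open>q'\<close> now depends on \<open>q\<close> and \<open>a\<close> alone, as in the
    detector.\<close>
  have q': "q' = ?R q"
    using w estimate_snoc by simp
  have q_states: "q \<subseteq> states S" and q'_states: "q' \<subseteq> states S"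
    unfolding w(1,2) by (rule estimate_subset_states)+
  have fin: "finite q" "finite q'"
    using q_states q'_states finite_states finite_subset by auto
  then have fin_r': "finite r'"
    using assms(3) finite_subset by blast
  \<comment> \<open>If \<open>q'\<close> has fewer than two elements, the bound is inherited from
    \<open>q'\<close>.\<close>
  have card_r': "card r' \<le> 2"
    using assms(5) card_mono[OF fin(2) assms(3)] by linarith
  have "\<forall>z\<in>r'. \<exists>x\<in>q. z \<in> ?R {x}"
    using assms(3) q' mem_UR_Reach_set_iff by fast
  then obtain f where f: "\<And>z. z \<in> r' \<Longrightarrow> f z \<in> q \<and> z \<in> ?R {f z}"
    by metis
  have "card (f ` r') \<le> 2"
    using card_image_le[OF fin_r', of f] card_r' by linarith
  then obtain r where r: "f ` r' \<subseteq> r" "r \<subseteq> q" "card r \<le> 2" "card q \<ge> 2 \<longrightarrow> card r = 2"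
    using obtain_card_2_superset[of q "f ` r'"] fin(1) f assms(4) by blast
  have r'_R: "r' \<subseteq> ?R r"
    using f r(1) mem_UR_Reach_set_iff by fast
  have R_q': "?R r \<subseteq> q'"
    unfolding q' by (intro UR_set_mono Reach_set_mono r(2))
  have fin_R: "finite (?R r)"
    using R_q' fin(2) finite_subset by blast
  \<comment> \<open>The two clauses of the detector, decided by the size of \<open>q'\<close>. If
    \<open>q'\<close> has at least two elements, the two elements of \<open>r'\<close> lie in
    \<open>?R r\<close>. Otherwise \<open>r'\<close> is all of \<open>q'\<close>, and
    \<open>?R r\<close> is squeezed between \<open>r'\<close> and \<open>q'\<close>.\<close>
  have "card (?R r) > 1 \<and> card r' = 2 \<or> card (?R r) = 1 \<and> r' = ?R r"
  proof (cases "card q' \<ge> 2")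
    case True
    then show ?thesis
      using assms(5) card_mono[OF fin_R r'_R] by linarith
  next
    case False
    have "card r' \<ge> 1"
      using assms(4) fin_r' by (simp add: Suc_le_eq card_gt_0_iff)
    then have "r' = q'"
      using False by (intro card_seteq[OF fin(2) assms(3)]) linarith
    then have "r' = ?R r"
      using r'_R R_q' by blast
    then show ?thesis
      using False \<open>r' = q'\<close> \<open>card r' \<ge> 1\<close> by auto
  qed
  \<comment> \<open>\<open>r\<close> is nonempty because it contains the image of the nonempty set
    \<open>r'\<close> under \<open>f\<close>.\<close>
  moreover have "r \<in> detector_states S" "r' \<in> detector_states S"
    using r assms(3,4) q_states q'_states card_r' by (auto simp: detector_states_def)
  ultimately have "(r, a, r') \<in> transitions (detector S)"
    using w(3) r'_R by (auto simp: detector_def Let_def)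
  then show ?thesis
    using r by blast
qed

end
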